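(* Let $n\ge 0$ be an integer, let $K_1,\ldots,K_n\subseteq X$ be non-empty closed convex sets, and let $\gamma_1,\ldots,\gamma_n$ be gauges on $X$. Then $\bar{x}\in X$ is a minimizer of the function $f:X\to\mathbb{R}$, $f(x)=\sum_{i=1}^n\mathrm{dist}_{\gamma_i}(x,K_i)$, if and only if there exist $\phi_1,\ldots,\phi_n\in X^\ast$ with $\gamma_i^\circ(-\phi_i)\le 1$ and $\mathrm{dist}_{\gamma_i}(\bar{x},K_i)=\inf_{y\in K_i}\langle\phi_i\mid\bar{x}-y\rangle$ for all $i\in\{1,\ldots,n\}$ such that $\sum_{i=1}^n\phi_i=0$.
   Context: $X$ is a finite-dimensional real vector space. A gauge on $X$ is a function $\gamma:X\to[0,+\infty)$ such that $\gamma(x)=0$ implies $x=0$; $\gamma(\lambda x)=\lambda\gamma(x)$ for all $x\in X$, $\lambda\ge 0$; and $\gamma(x+y)\le\gamma(x)+\gamma(y)$ for all $x,y\in X$ (no symmetry is assumed). $X^\ast$ is the space of linear functionals on $X$, and $\langle\phi\mid x\rangle$ denotes $\phi(x)$. The polar function of $\gamma$ is $\gamma^\circ:X^\ast\to[0,+\infty)$, $\gamma^\circ(\phi)=\inf\{\lambda>0:\langle\phi\mid x\rangle\le\lambda\gamma(x)\text{ for all }x\in X\}$. The distance function of $K\subseteq X$ with respect to $\gamma$ is $\mathrm{dist}_\gamma(x,K)=\inf\{\gamma(y-x):y\in K\}$. *)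

theory Defs
  imports "HOL-Analysis.Analysis"
begin

text \<open>
  Gauges in the sense of convex geometry: asymmetric norms. The constant \<open>gauge\<close> of
  the library is the unrelated notion from Henstock--Kurzweil integration.
\<close>

definition is_gauge :: "('a::real_vector \<Rightarrow> real) \<Rightarrow> bool" where
  "is_gauge \<gamma> \<longleftrightarrow>
     (\<forall>x. 0 \<le> \<gamma> x) \<and>
     (\<forall>x. \<gamma> x = 0 \<longrightarrow> x = 0) \<and>
     (\<forall>x. \<forall>c\<ge>0. \<gamma> (c *\<^sub>R x) = c * \<gamma> x) \<and>
     (\<forall>x y. \<gamma> (x + y) \<le> \<gamma> x + \<gamma> y)"

text \<open>
  The polar is meant to be applied to linear functionals \<open>\<phi>\<close>. In finite dimension the set
  below is then non-empty (and bounded below by 0), so the real-valued infimum is the true one.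
\<close>

definition gauge_polar :: "('a::real_vector \<Rightarrow> real) \<Rightarrow> ('a \<Rightarrow> real) \<Rightarrow> real" where
  "gauge_polar \<gamma> \<phi> = Inf {c. 0 < c \<and> (\<forall>x. \<phi> x \<le> c * \<gamma> x)}"

definition gauge_dist :: "('a::real_vector \<Rightarrow> real) \<Rightarrow> 'a \<Rightarrow> 'a set \<Rightarrow> real" where
  "gauge_dist \<gamma> x K = (INF y\<in>K. \<gamma> (y - x))"

end

theory Submission
  imports Defs
begin

text \<open>
  A point minimizes \<open>f\<close> exactly when \<open>0\<close> is a subgradient of \<open>f\<close> there. The theorem follows from
  two facts about subgradients: a subgradient of a sum of convex functions is a sum of subgradients
  of the summands (\<open>subgradient_sum_split\<close>), and the subgradients \<open>\<phi>\<close> of \<open>dist\<^sub>\<gamma> (\<sqdot>, K)\<close> at \<open>x\<close>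
  are the linear functionals with \<open>- \<phi> \<le> \<gamma>\<close> and \<open>dist\<^sub>\<gamma> (x, K) = inf\<^sub>y \<phi> (x - y)\<close>
  (\<open>subgradient_gauge_dist_iff\<close>).

  The sum rule rests on a Hahn--Banach argument. A sublinear function on a finite-dimensional
  space is pushed down until it is linear along each vector of a basis; the directions in which it
  is linear form a subspace, so it is then a linear minorant of the original function. Passing to
  the directional derivative at the origin extends this to convex functions \<open>h\<close> with \<open>h 0 = 0\<close>, and
  applying that to an infimal convolution yields a linear functional between a concave and a convex
  function that touch at the origin. This separation is the sum rule for two functions; induction
  gives any finite number.

  It remains to translate \<open>- \<phi> \<le> \<gamma>\<close> into \<open>\<gamma>\<degree> (- \<phi>) \<le> 1\<close>. The polar is an infimum of reals, and
  its value carries information only if some multiple of \<open>\<gamma>\<close> dominates \<open>- \<phi>\<close>. That is the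
  comparison of a gauge with the \<open>\<ell>\<^sup>1\<close> norm of coordinates, proved by compactness of the unit sphere
  of coordinate vectors (\<open>gauge_ge_l1\<close>).
\<close>

section \<open>Linear minorants of sublinear functions\<close>

definition sublinear :: "('a::real_vector \<Rightarrow> real) \<Rightarrow> bool" where
  "sublinear p \<longleftrightarrow> (\<forall>x y. p (x + y) \<le> p x + p y) \<and> (\<forall>c\<ge>0. \<forall>x. p (c *\<^sub>R x) = c * p x)"

lemma sublinear_add: "sublinear p \<Longrightarrow> p (x + y) \<le> p x + p y"
  by (simp add: sublinear_def)

lemma sublinear_scaleR: "sublinear p \<Longrightarrow> 0 \<le> c \<Longrightarrow> p (c *\<^sub>R x) = c * p x"
  by (simp add: sublinear_def)

lemma sublinear_zero: "sublinear p \<Longrightarrow> p 0 = 0"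
  using sublinear_scaleR[of p 0 0] by simp

lemma sublinear_minus_le: "sublinear p \<Longrightarrow> - p (- x) \<le> p x"
  using sublinear_add[of p x "- x"] by (simp add: sublinear_zero)

lemma sublinearI:
  assumes add: "\<And>x y. p (x + y) \<le> p x + p y"
    and scale: "\<And>c x. 0 < c \<Longrightarrow> p (c *\<^sub>R x) \<le> c * p x"
    and zero: "p 0 = 0"
  shows "sublinear p"
proof -
  have "p (c *\<^sub>R x) = c * p x" if "0 \<le> c" for c x
  proof (cases "c = 0")
    case False
    with that have c: "0 < c" by simp
    have "p x = p ((1 / c) *\<^sub>R (c *\<^sub>R x))" using c by simp
    also have "\<dots> \<le> (1 / c) * p (c *\<^sub>R x)" using c by (intro scale) simp
    finally have "c * p x \<le> p (c *\<^sub>R x)" using c by (simp add: field_simps)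
    with scale[OF c, of x] show ?thesis by simp
  qed (simp add: zero)
  with add show ?thesis by (simp add: sublinear_def)
qed

text \<open>
  The subadditivity bound \<open>0 \<le> p v + p (- v)\<close> is an equality exactly when \<open>p\<close> is linear on the
  line through \<open>v\<close>. Replacing \<open>p\<close> by \<open>x \<mapsto> inf\<^sub>t (p (x + t v) - t p v)\<close> forces this equality
  for one direction \<open>v\<close>. It is stated as an inequality so that it is visibly inherited by every
  smaller function.
\<close>

lemma sublinear_linearize_along:
  assumes p: "sublinear p"
  obtains q where "sublinear q" "\<And>x. q x \<le> p x" "q v + q (- v) \<le> 0"
proof -
  define F where "F x t = p (x + t *\<^sub>R v) - t * p v" for x t
  define q where "q x = (INF t\<in>{0..}. F x t)" for x
  have lower: "- p (- x) \<le> F x t" if "0 \<le> t" for x t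
    using sublinear_add[OF p, of "x + t *\<^sub>R v" "- x"] sublinear_scaleR[OF p that, of v]
    by (simp add: F_def)
  have bdd: "bdd_below (F x ` {0..})" for x
    by (rule bdd_belowI2[where m = "- p (- x)"]) (simp add: lower)
  have q_le: "q x \<le> F x t" if "0 \<le> t" for x t
    unfolding q_def using that by (intro cINF_lower bdd) simp
  have F_add: "F (x + y) (s + t) \<le> F x s + F y t" for x y s t
    using sublinear_add[OF p, of "x + s *\<^sub>R v" "y + t *\<^sub>R v"]
    by (simp add: F_def algebra_simps)
  have "q (x + y) \<le> q x + q y" for x y
  proof -
    have "q (x + y) - F y t \<le> q x" if "0 \<le> t" for t
      unfolding q_def[of x]
    proof (rule cINF_greatest)
      fix s :: real assume "s \<in> {0..}"
      then show "q (x + y) - F y t \<le> F x s"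
        using q_le[of "s + t" "x + y"] F_add[of x y s t] that by simp
    qed simp
    then have "q (x + y) - q x \<le> q y"
      unfolding q_def[of y] by (intro cINF_greatest) (auto simp: algebra_simps)
    then show ?thesis by simp
  qed
  moreover have "q (c *\<^sub>R x) \<le> c * q x" if c: "0 < c" for c x
  proof -
    have "q (c *\<^sub>R x) / c \<le> q x"
      unfolding q_def[of x]
    proof (rule cINF_greatest)
      fix t :: real assume t: "t \<in> {0..}"
      have "F (c *\<^sub>R x) (c * t) = c * F x t"
        using sublinear_scaleR[OF p, of c "x + t *\<^sub>R v"] c by (simp add: F_def algebra_simps)
      with q_le[of "c * t" "c *\<^sub>R x"] c t show "q (c *\<^sub>R x) / c \<le> F x t"
        by (simp add: field_simps)
    qed simp
    with c show ?thesis by (simp add: field_simps)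
  qed
  moreover have "q 0 = 0"
  proof (rule antisym)
    show "q 0 \<le> 0" using q_le[of 0 0] by (simp add: F_def sublinear_zero[OF p])
    show "0 \<le> q 0" unfolding q_def
      using lower[of _ 0] by (intro cINF_greatest) (auto simp: sublinear_zero[OF p])
  qed
  ultimately have "sublinear q" by (rule sublinearI)
  moreover have "q x \<le> p x" for x using q_le[of 0 x] by (simp add: F_def)
  moreover have "q v + q (- v) \<le> 0"
    using q_le[of 0 v] q_le[of 1 "- v"] by (simp add: F_def sublinear_zero[OF p])
  ultimately show ?thesis by (rule that)
qed

lemma sublinear_linearize_finite:
  assumes "finite V" "sublinear p"
  obtains q where "sublinear q" "\<And>x. q x \<le> p x" "\<And>v. v \<in> V \<Longrightarrow> q v + q (- v) \<le> 0"
  using assms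
proof (induction V arbitrary: thesis rule: finite_induct)
  case empty
  then show ?case by auto
next
  case (insert v V)
  obtain r where r: "sublinear r" "\<And>x. r x \<le> p x" "\<And>w. w \<in> V \<Longrightarrow> r w + r (- w) \<le> 0"
    using insert.IH insert.prems by blast
  obtain q where q: "sublinear q" "\<And>x. q x \<le> r x" "q v + q (- v) \<le> 0"
    using sublinear_linearize_along[OF r(1)] by blast
  show ?case
  proof (rule insert.prems(1))
    show "q w + q (- w) \<le> 0" if "w \<in> insert v V" for w
      using that q(2)[of w] q(2)[of "- w"] q(3) r(3)[of w] by fastforce
    show "q x \<le> p x" for x using q(2)[of x] r(2)[of x] by simp
  qed (rule q(1))
qed

text \<open>The directions in which a sublinear function is linear form a subspace.\<close>

lemma sublinear_imp_linear:
  assumes q: "sublinear q" and V: "\<And>v. v \<in> V \<Longrightarrow> q v + q (- v) \<le> 0" and span: "span V = UNIV"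
  shows "linear q"
proof -
  let ?W = "{x. q x + q (- x) \<le> 0}"
  have "subspace ?W"
  proof (rule subspaceI)
    show "0 \<in> ?W" by (simp add: sublinear_zero[OF q])
  next
    fix x y assume "x \<in> ?W" "y \<in> ?W"
    then show "x + y \<in> ?W"
      using sublinear_add[OF q, of x y] sublinear_add[OF q, of "- x" "- y"] by simp
  next
    fix c x assume x: "x \<in> ?W"
    have nonneg: "c *\<^sub>R x \<in> ?W" if "0 \<le> c" "x \<in> ?W" for c x
      using that sublinear_scaleR[OF q that(1), of x] sublinear_scaleR[OF q that(1), of "- x"]
      by (simp flip: distrib_left add: mult_nonneg_nonpos)
    show "c *\<^sub>R x \<in> ?W"
    proof (cases "0 \<le> c")
      case False
      have "- x \<in> ?W" using x by (simp add: add.commute)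
      with False nonneg[of "- c" "- x"] show ?thesis by simp
    qed (use nonneg x in blast)
  qed
  then have "span V \<subseteq> ?W" using V by (intro span_minimal) auto
  then have "q x + q (- x) \<le> 0" for x using span by auto
  then have minus: "q (- x) = - q x" for x
    using sublinear_minus_le[OF q, of x] by (smt (verit))
  show ?thesis
  proof (rule linearI)
    fix x y
    show "q (x + y) = q x + q y"
      using sublinear_add[OF q, of x y] sublinear_add[OF q, of "x + y" "- y"] minus[of y] by simp
  next
    fix c x
    show "q (c *\<^sub>R x) = c *\<^sub>R q x"
    proof (cases "0 \<le> c")
      case False
      then have "q (- ((- c) *\<^sub>R x)) = c * q x"
        using minus[of "(- c) *\<^sub>R x"] sublinear_scaleR[OF q, of "- c" x] by simp
      then show ?thesis by simp
    qed (simp add: sublinear_scaleR[OF q])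
  qed
qed

lemma sublinear_linear_minorant:
  fixes B :: "'a::real_vector set" and p :: "'a \<Rightarrow> real"
  assumes "finite B" "span B = UNIV" "sublinear p"
  obtains \<phi> where "linear \<phi>" "\<And>x. \<phi> x \<le> p x"
proof -
  obtain q where "sublinear q" "\<And>x. q x \<le> p x" "\<And>v. v \<in> B \<Longrightarrow> q v + q (- v) \<le> 0"
    using sublinear_linearize_finite[OF assms(1,3)] by blast
  then show ?thesis using that sublinear_imp_linear[OF _ _ assms(2)] by blast
qed

section \<open>Subgradients and the sum rule\<close>

text \<open>
  The function \<open>x \<mapsto> inf\<^sub>t h (t x) / t\<close>, with \<open>t > 0\<close>, is the directional derivative of \<open>h\<close> at the origin. It is
  sublinear and lies below \<open>h\<close>, which reduces the convex case to the sublinear one.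
\<close>

lemma convex_linear_minorant:
  fixes B :: "'a::real_vector set" and h :: "'a \<Rightarrow> real"
  assumes B: "finite B" "span B = UNIV" and h: "convex_on UNIV h" and h0: "h 0 = 0"
  obtains \<phi> where "linear \<phi>" "\<And>x. \<phi> x \<le> h x"
proof -
  define F where "F x t = h (t *\<^sub>R x) / t" for x and t :: real
  define p where "p x = (INF t\<in>{0<..}. F x t)" for x
  have conv: "h (u *\<^sub>R x + v *\<^sub>R y) \<le> u * h x + v * h y"
    if "0 \<le> u" "0 \<le> v" "u + v = 1" for u v x y
    using h that by (simp add: convex_on_def)
  have lower: "- h (- x) \<le> F x t" if t: "0 < t" for x t
  proof -
    \<comment> \<open>The origin is a convex combination of \<open>t x\<close> and \<open>- x\<close>.\<close>
    have "h ((1 / (1 + t)) *\<^sub>R (t *\<^sub>R x) + (t / (1 + t)) *\<^sub>R (- x))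
      \<le> 1 / (1 + t) * h (t *\<^sub>R x) + t / (1 + t) * h (- x)"
      using t by (intro conv) (auto simp: field_simps)
    then have "0 \<le> (h (t *\<^sub>R x) + t * h (- x)) / (1 + t)"
      by (simp add: h0 add_divide_distrib)
    then show ?thesis using t by (simp add: F_def field_simps zero_le_divide_iff)
  qed
  have bdd: "bdd_below (F x ` {0<..})" for x
    by (rule bdd_belowI2[where m = "- h (- x)"]) (simp add: lower)
  have p_le: "p x \<le> F x t" if "0 < t" for x t
    unfolding p_def using that by (intro cINF_lower bdd) simp
  have F_add: "F (x + y) (s * t / (s + t)) \<le> F x s + F y t" if st: "0 < s" "0 < t" for x y s t
  proof -
    \<comment> \<open>With this step the point \<open>u (x + y)\<close> is a convex combination of \<open>s x\<close> and \<open>t y\<close>.\<close>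
    let ?u = "s * t / (s + t)"
    have u: "0 < ?u" using st by simp
    have "h (?u *\<^sub>R (x + y)) = h ((t / (s + t)) *\<^sub>R (s *\<^sub>R x) + (s / (s + t)) *\<^sub>R (t *\<^sub>R y))"
      by (simp add: scaleR_add_right mult.commute)
    also have "\<dots> \<le> t / (s + t) * h (s *\<^sub>R x) + s / (s + t) * h (t *\<^sub>R y)"
      using st by (intro conv) (auto simp flip: add_divide_distrib)
    also have "\<dots> = ?u * (F x s + F y t)"
      using st by (simp add: F_def distrib_left)
    finally show ?thesis
      using u unfolding F_def[of "x + y"] by (metis mult.commute pos_divide_le_eq)
  qed
  have "p (x + y) \<le> p x + p y" for x y
  proof -
    have "p (x + y) - F y t \<le> p x" if "0 < t" for t
      unfolding p_def[of x]
    proof (rule cINF_greatest)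
      fix s :: real assume "s \<in> {0<..}"
      then show "p (x + y) - F y t \<le> F x s"
        using p_le[of "s * t / (s + t)" "x + y"] F_add[of s t x y] that by simp
    qed simp
    then have "p (x + y) - p x \<le> p y"
      unfolding p_def[of y] by (intro cINF_greatest) (auto simp: algebra_simps)
    then show ?thesis by simp
  qed
  moreover have "p (c *\<^sub>R x) \<le> c * p x" if c: "0 < c" for c x
  proof -
    have "p (c *\<^sub>R x) / c \<le> p x"
      unfolding p_def[of x]
    proof (rule cINF_greatest)
      fix t :: real assume t: "t \<in> {0<..}"
      have "F (c *\<^sub>R x) (t / c) = c * F x t"
        using c by (simp add: F_def)
      with p_le[of "t / c" "c *\<^sub>R x"] c t show "p (c *\<^sub>R x) / c \<le> F x t"
        by (simp add: field_simps)
    qed simp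
    with c show ?thesis by (simp add: field_simps)
  qed
  moreover have "p 0 = 0" by (simp add: p_def F_def h0)
  ultimately have "sublinear p" by (rule sublinearI)
  then obtain \<phi> where "linear \<phi>" "\<And>x. \<phi> x \<le> p x"
    using sublinear_linear_minorant[OF B] by blast
  moreover have "p x \<le> h x" for x using p_le[of 1 x] by (simp add: F_def)
  ultimately have "linear \<phi>" "\<And>x. \<phi> x \<le> h x" by (blast, meson order_trans)
  then show ?thesis by (rule that)
qed

lemma weighted_cINF_greatest:
  fixes F :: "'a \<Rightarrow> real" and G :: "'b \<Rightarrow> real"
  assumes ne: "A \<noteq> {}" "B \<noteq> {}" and uv: "0 < u" "0 < v"
    and le: "\<And>a b. a \<in> A \<Longrightarrow> b \<in> B \<Longrightarrow> c \<le> u * F a + v * G b"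
  shows "c \<le> u * (INF a\<in>A. F a) + v * (INF b\<in>B. G b)"
proof -
  have "(c - v * G b) / u \<le> (INF a\<in>A. F a)" if "b \<in> B" for b
    using ne(1) uv le[OF _ that] by (intro cINF_greatest) (auto simp: field_simps)
  then have "(c - u * (INF a\<in>A. F a)) / v \<le> (INF b\<in>B. G b)"
    using ne(2) uv by (intro cINF_greatest) (auto simp: field_simps)
  then show ?thesis using uv by (simp add: field_simps)
qed

text \<open>
  A linear functional lies between \<open>- G\<close> and \<open>F\<close> as soon as it lies below their infimal
  convolution \<open>h v = inf\<^sub>z (F (z + v) + G z)\<close>: take \<open>z = 0\<close> for \<open>F\<close> and \<open>v = - z\<close> for \<open>G\<close>. The
  infimum is finite because, by joint convexity in \<open>v\<close> and \<open>z\<close>, the average of a value competing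
  for \<open>h v\<close> and one competing for \<open>h (- v)\<close> is at least a value of \<open>F + G\<close>, which is nonnegative.
\<close>

lemma convex_sandwich:
  fixes B :: "'a::real_vector set" and F G :: "'a \<Rightarrow> real"
  assumes B: "finite B" "span B = UNIV"
    and F: "convex_on UNIV F" "F 0 = 0" and G: "convex_on UNIV G" "G 0 = 0"
    and nonneg: "\<And>z. 0 \<le> F z + G z"
  obtains \<psi> where "linear \<psi>" "\<And>x. \<psi> x \<le> F x" "\<And>x. - \<psi> x \<le> G x"
proof -
  define H where "H v z = F (z + v) + G z" for v z
  define h where "h v = (INF z. H v z)" for v
  have convH: "H (s *\<^sub>R v + t *\<^sub>R w) (s *\<^sub>R y + t *\<^sub>R z) \<le> s * H v y + t * H w z"
    if st: "0 \<le> s" "0 \<le> t" "s + t = 1" for s t v w y z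
  proof -
    have "F (s *\<^sub>R (y + v) + t *\<^sub>R (z + w)) \<le> s * F (y + v) + t * F (z + w)"
      "G (s *\<^sub>R y + t *\<^sub>R z) \<le> s * G y + t * G z"
      using F(1) G(1) st by (auto simp: convex_on_def)
    then show ?thesis by (simp add: H_def algebra_simps)
  qed
  have lower: "- H (- v) 0 \<le> H v z" for v z
  proof -
    have "0 \<le> H 0 ((1/2) *\<^sub>R z)" by (simp add: H_def nonneg)
    also have "\<dots> \<le> 1/2 * H v z + 1/2 * H (- v) 0"
      using convH[of "1/2" "1/2" v "- v" z 0] by simp
    finally show ?thesis by (simp add: field_simps)
  qed
  have bdd: "bdd_below (range (H v))" for v
    by (rule bdd_belowI2[where m = "- H (- v) 0"]) (simp add: lower)
  have h_le: "h v \<le> H v z" for v z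
    unfolding h_def by (intro cINF_lower bdd) simp
  have "convex_on UNIV h"
  proof
    fix t :: real and x y assume t: "0 < t" "t < 1"
    have "h ((1 - t) *\<^sub>R x + t *\<^sub>R y) \<le> (1 - t) * H x a + t * H y b" for a b
      by (rule order_trans[OF h_le convH]) (use t in auto)
    with t show "h ((1 - t) *\<^sub>R x + t *\<^sub>R y) \<le> (1 - t) * h x + t * h y"
      unfolding h_def[of x] h_def[of y] by (intro weighted_cINF_greatest) auto
  qed simp
  moreover have "h 0 = 0"
  proof (rule antisym)
    show "h 0 \<le> 0" using h_le[of 0 0] by (simp add: H_def F G)
    show "0 \<le> h 0" unfolding h_def by (intro cINF_greatest) (auto simp: H_def nonneg)
  qed
  ultimately obtain \<psi> where \<psi>: "linear \<psi>" "\<And>x. \<psi> x \<le> h x"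
    using convex_linear_minorant[OF B] by blast
  have "\<psi> x \<le> F x" for x
    using \<psi>(2)[of x] h_le[of x 0] by (simp add: H_def G)
  moreover have "- \<psi> x \<le> G x" for x
    using \<psi>(2)[of "- x"] h_le[of "- x" x] by (simp add: H_def F linear_neg[OF \<psi>(1)])
  ultimately show ?thesis using that \<psi>(1) by blast
qed

definition subgradient :: "('a::real_vector \<Rightarrow> real) \<Rightarrow> 'a \<Rightarrow> ('a \<Rightarrow> real) \<Rightarrow> bool" where
  "subgradient f x \<phi> \<longleftrightarrow> linear \<phi> \<and> (\<forall>y. f x + \<phi> (y - x) \<le> f y)"

lemma subgradientD:
  assumes "subgradient f x \<phi>"
  shows "linear \<phi>" "f x + \<phi> (y - x) \<le> f y"
  using assms by (auto simp: subgradient_def)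

lemma subgradient_const_zero:
  assumes "subgradient (\<lambda>_. c) x \<phi>"
  shows "\<phi> v = 0"
  using subgradientD(2)[OF assms, of "x + v"] subgradientD(2)[OF assms, of "x - v"]
  by (simp add: linear_neg[OF subgradientD(1)[OF assms]])

lemma convex_on_translate:
  assumes "convex_on UNIV f"
  shows "convex_on UNIV (\<lambda>v. f (x + v))"
proof
  fix t :: real and y z assume t: "0 < t" "t < 1"
  have "x + ((1 - t) *\<^sub>R y + t *\<^sub>R z) = (1 - t) *\<^sub>R (x + y) + t *\<^sub>R (x + z)"
    by (simp add: algebra_simps)
  then show "f (x + ((1 - t) *\<^sub>R y + t *\<^sub>R z)) \<le> (1 - t) * f (x + y) + t * f (x + z)"
    using convex_onD[OF assms, of t "x + y" "x + z"] t by simp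
qed simp

lemma linear_imp_convex_on:
  assumes "linear \<phi>"
  shows "convex_on UNIV (\<phi> :: _ \<Rightarrow> real)"
  by rule (auto simp: linear_add[OF assms] linear_scale[OF assms])

text \<open>
  After translating \<open>x\<close> to the origin and subtracting \<open>\<phi>\<close> and the values at \<open>x\<close>, the assumption
  says that \<open>F + G\<close> is nonnegative and that \<open>F\<close> and \<open>G\<close> both vanish at the origin. If \<open>\<chi>\<close>
  lies between \<open>- G\<close> and \<open>F\<close>, then \<open>\<phi> + \<chi>\<close> is a subgradient of \<open>f\<close> and \<open>- \<chi>\<close> one of \<open>g\<close>.
\<close>

lemma subgradient_add_split:
  fixes B :: "'a::real_vector set" and f g :: "'a \<Rightarrow> real"
  assumes B: "finite B" "span B = UNIV"
    and f: "convex_on UNIV f" and g: "convex_on UNIV g"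
    and \<phi>: "subgradient (\<lambda>x. f x + g x) x \<phi>"
  obtains \<psi> where "subgradient f x \<psi>" "subgradient g x (\<lambda>v. \<phi> v - \<psi> v)"
proof -
  have lin: "linear \<phi>" using \<phi> by (rule subgradientD)
  define F where "F v = f (x + v) + (- \<phi> v + - f x)" for v
  define G where "G v = g (x + v) + - g x" for v
  have "linear (\<lambda>v. - \<phi> v)" using linear_compose_neg[OF lin] .
  then have "convex_on UNIV F"
    unfolding F_def
    by (intro convex_on_add[OF convex_on_translate[OF f]] convex_on_add[OF linear_imp_convex_on])
      (simp_all add: convex_on_const)
  moreover have "convex_on UNIV G"
    unfolding G_def
    by (intro convex_on_add convex_on_translate[OF g]) (simp add: convex_on_const)
  moreover have "F 0 = 0" "G 0 = 0" by (simp_all add: F_def G_def linear_0[OF lin])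
  moreover have "0 \<le> F z + G z" for z
    using subgradientD(2)[OF \<phi>, of "x + z"] by (simp add: F_def G_def)
  ultimately obtain \<psi> where \<psi>: "linear \<psi>" "\<And>v. \<psi> v \<le> F v" "\<And>v. - \<psi> v \<le> G v"
    using convex_sandwich[OF B, of F G] by blast
  show ?thesis
  proof
    have "f x + (\<phi> (y - x) + \<psi> (y - x)) \<le> f y" for y
      using \<psi>(2)[of "y - x"] by (simp add: F_def)
    then show "subgradient f x (\<lambda>v. \<phi> v + \<psi> v)"
      using linear_compose_add[OF lin \<psi>(1)] by (simp add: subgradient_def)
    have "g x - \<psi> (y - x) \<le> g y" for y
      using \<psi>(3)[of "y - x"] by (simp add: G_def)
    then show "subgradient g x (\<lambda>v. \<phi> v - (\<phi> v + \<psi> v))"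
      using linear_compose_neg[OF \<psi>(1)] by (simp add: subgradient_def)
  qed
qed

lemma convex_on_sum_functions:
  assumes "finite I" "\<And>i. i \<in> I \<Longrightarrow> convex_on UNIV (f i)"
  shows "convex_on UNIV (\<lambda>x. \<Sum>i\<in>I. f i x)"
  using assms by (induction I rule: finite_induct) (auto intro!: convex_on_add simp: convex_on_const)

lemma subgradient_sum_split:
  fixes B :: "'a::real_vector set" and f :: "'i \<Rightarrow> 'a \<Rightarrow> real"
  assumes B: "finite B" "span B = UNIV" and I: "finite I"
    and f: "\<And>i. i \<in> I \<Longrightarrow> convex_on UNIV (f i)"
    and \<phi>: "subgradient (\<lambda>y. \<Sum>i\<in>I. f i y) x \<phi>"
  obtains \<psi> where "\<And>i. i \<in> I \<Longrightarrow> subgradient (f i) x (\<psi> i)" "\<And>v. (\<Sum>i\<in>I. \<psi> i v) = \<phi> v"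
  using I f \<phi>
proof (induction I arbitrary: \<phi> thesis rule: finite_induct)
  case empty
  show ?case
    by (rule empty.prems(1)) (use subgradient_const_zero empty.prems(3) in auto)
next
  case (insert j I)
  have "subgradient (\<lambda>y. f j y + (\<Sum>i\<in>I. f i y)) x \<phi>"
    using insert.prems(3) insert.hyps by simp
  then obtain \<xi> where \<xi>: "subgradient (f j) x \<xi>"
      "subgradient (\<lambda>y. \<Sum>i\<in>I. f i y) x (\<lambda>v. \<phi> v - \<xi> v)"
    using subgradient_add_split[OF B, of "f j" "\<lambda>y. \<Sum>i\<in>I. f i y" x \<phi>]
      convex_on_sum_functions[OF insert.hyps(1)] insert.prems(2) by blast
  obtain \<psi> where \<psi>: "\<And>i. i \<in> I \<Longrightarrow> subgradient (f i) x (\<psi> i)"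
      "\<And>v. (\<Sum>i\<in>I. \<psi> i v) = \<phi> v - \<xi> v"
    using insert.IH[OF _ _ \<xi>(2)] insert.prems(2) by blast
  show ?case
  proof (rule insert.prems(1))
    show "subgradient (f i) x ((\<psi>(j := \<xi>)) i)" if "i \<in> insert j I" for i
      using that \<xi>(1) \<psi>(1) by auto
    have "(\<Sum>i\<in>I. (\<psi>(j := \<xi>)) i v) = (\<Sum>i\<in>I. \<psi> i v)" for v
      using insert.hyps(2) by (intro sum.cong) auto
    then show "(\<Sum>i\<in>insert j I. (\<psi>(j := \<xi>)) i v) = \<phi> v" for v
      using insert.hyps \<psi>(2)[of v] by simp
  qed
qed

section \<open>Gauges, their polars and distance functions\<close>

lemma gauge_sublinear: "is_gauge \<gamma> \<Longrightarrow> sublinear \<gamma>"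
  by (simp add: is_gauge_def sublinear_def)

lemma gauge_nonneg: "is_gauge \<gamma> \<Longrightarrow> 0 \<le> \<gamma> x"
  by (simp add: is_gauge_def)

lemma sublinear_sum_le:
  assumes p: "sublinear p" and "finite B"
  shows "p (\<Sum>b\<in>B. f b) \<le> (\<Sum>b\<in>B. p (f b))"
  using assms(2)
proof (induction B rule: finite_induct)
  case (insert b B)
  then show ?case using sublinear_add[OF p, of "f b" "\<Sum>b\<in>B. f b"] by simp
qed (simp add: sublinear_zero[OF p])

lemma sublinear_scaleR_le:
  assumes p: "sublinear p"
  shows "p (c *\<^sub>R x) \<le> \<bar>c\<bar> * (\<bar>p x\<bar> + \<bar>p (- x)\<bar>)"
proof (cases "0 \<le> c")
  case True
  then show ?thesis
    by (simp add: sublinear_scaleR[OF p] mult_left_mono)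
next
  case False
  then show ?thesis
    using sublinear_scaleR[OF p, of "- c" "- x"] by (simp add: mult_left_mono_neg)
qed

text \<open>
  By subadditivity, the value of \<open>p\<close> changes by at most a weighted \<open>\<ell>\<^sup>1\<close> norm of the change in the
  coordinates. The weight of \<open>b\<close> accounts for both \<open>p b\<close> and \<open>p (- b)\<close>, which may differ.
\<close>

lemma continuous_on_sublinear_coordinates:
  assumes p: "sublinear p" and B: "finite B"
  shows "continuous_on UNIV (\<lambda>u. p (\<Sum>b\<in>B. u b *\<^sub>R b))"
proof -
  define m where "m b = \<bar>p b\<bar> + \<bar>p (- b)\<bar>" for b
  let ?N = "\<lambda>u w. \<Sum>b\<in>B. \<bar>u b - w b\<bar> * m b"
  let ?x = "\<lambda>u. \<Sum>b\<in>B. u b *\<^sub>R b"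
  have le: "p (?x u) - p (?x w) \<le> ?N u w" for u w
  proof -
    have "p (?x u) \<le> p (?x w) + p (\<Sum>b\<in>B. (u b - w b) *\<^sub>R b)"
      using sublinear_add[OF p, of "?x w" "\<Sum>b\<in>B. (u b - w b) *\<^sub>R b"]
      by (simp add: scaleR_diff_left sum_subtractf)
    also have "p (\<Sum>b\<in>B. (u b - w b) *\<^sub>R b) \<le> (\<Sum>b\<in>B. p ((u b - w b) *\<^sub>R b))"
      by (rule sublinear_sum_le[OF p B])
    also have "\<dots> \<le> ?N u w"
      unfolding m_def by (intro sum_mono sublinear_scaleR_le[OF p])
    finally show ?thesis by simp
  qed
  show ?thesis
    unfolding continuous_on_def
  proof
    fix w :: "'a \<Rightarrow> real"
    have "continuous_on UNIV (\<lambda>u. ?N u w)"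
      by (intro continuous_intros continuous_on_product_coordinates)
    then have "((\<lambda>u. ?N u w) \<longlongrightarrow> ?N w w) (at w)"
      unfolding continuous_on_def by blast
    then have lim: "((\<lambda>u. ?N u w) \<longlongrightarrow> 0) (at w)" by simp
    have "?N w u = ?N u w" for u by (simp add: abs_minus_commute)
    then have "norm (p (?x u) - p (?x w)) \<le> ?N u w" for u
      using le[of u w] le[of w u] by (simp add: abs_le_iff)
    with lim have "((\<lambda>u. p (?x u) - p (?x w)) \<longlongrightarrow> 0) (at w)"
      by (intro Lim_null_comparison[OF _ lim]) auto
    then show "((\<lambda>u. p (?x u)) \<longlongrightarrow> p (?x w)) (at w)"
      by (simp add: LIM_zero_iff)
  qed
qed

text \<open>
  Coordinate vectors are functions vanishing outside the basis, so that the unit sphere sits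
  inside a product of compact intervals and points and Tychonoff's theorem applies.
\<close>

lemma compact_l1_sphere:
  assumes "finite B"
  shows "compact {u :: 'b \<Rightarrow> real. (\<forall>b. b \<notin> B \<longrightarrow> u b = 0) \<and> (\<Sum>b\<in>B. \<bar>u b\<bar>) = 1}" (is "compact ?S")
proof -
  let ?C = "PiE UNIV (\<lambda>b. if b \<in> B then {-1..1} else {0::real})"
  have "compactin (product_topology (\<lambda>_. euclidean) UNIV) ?C"
    unfolding compactin_PiE by auto
  then have C: "compact ?C" by (simp add: euclidean_product_topology)
  have "continuous_on UNIV (\<lambda>u :: 'b \<Rightarrow> real. \<Sum>b\<in>B. \<bar>u b\<bar>)"
    by (intro continuous_intros continuous_on_product_coordinates)
  then have "closed ((\<lambda>u :: 'b \<Rightarrow> real. \<Sum>b\<in>B. \<bar>u b\<bar>) -` {1})"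
    by (intro closed_vimage) auto
  moreover have "?S = ?C \<inter> (\<lambda>u. \<Sum>b\<in>B. \<bar>u b\<bar>) -` {1}"
  proof (intro equalityI subsetI)
    fix u assume u: "u \<in> ?S"
    have "\<bar>u b\<bar> \<le> 1" if "b \<in> B" for b
      using u member_le_sum[of b B "\<lambda>b. \<bar>u b\<bar>"] that assms by simp
    with u show "u \<in> ?C \<inter> (\<lambda>u. \<Sum>b\<in>B. \<bar>u b\<bar>) -` {1}"
      by (auto simp: abs_le_iff minus_le_iff)
  next
    fix u assume "u \<in> ?C \<inter> (\<lambda>u. \<Sum>b\<in>B. \<bar>u b\<bar>) -` {1}"
    then show "u \<in> ?S" by (auto simp: PiE_def Pi_def split: if_splits)
  qed
  ultimately show ?thesis using compact_Int_closed[OF C] by simp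
qed

text \<open>
  The constant is the minimum of the gauge over the unit sphere of coordinate vectors. It is
  positive because independence keeps the origin away from the image of the sphere, and
  homogeneity carries the bound from the sphere to all coordinate vectors.
\<close>

lemma gauge_ge_l1:
  fixes B :: "'a::real_vector set"
  assumes \<gamma>: "is_gauge \<gamma>" and B: "finite B" "independent B"
  obtains m where "0 < m" "\<And>u. m * (\<Sum>b\<in>B. \<bar>u b\<bar>) \<le> \<gamma> (\<Sum>b\<in>B. u b *\<^sub>R b)"
proof (cases "B = {}")
  case True
  then show ?thesis using that[of 1] gauge_nonneg[OF \<gamma>] by simp
next
  case False
  then obtain b0 where b0: "b0 \<in> B" by blast
  define S where "S = {u :: 'a \<Rightarrow> real. (\<forall>b. b \<notin> B \<longrightarrow> u b = 0) \<and> (\<Sum>b\<in>B. \<bar>u b\<bar>) = 1}"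
  let ?g = "\<lambda>u. \<gamma> (\<Sum>b\<in>B. u b *\<^sub>R b)"
  note sub = gauge_sublinear[OF \<gamma>]
  have "(\<Sum>b\<in>B. \<bar>of_bool (b = b0) :: real\<bar>) = 1"
  proof -
    have "(\<Sum>b\<in>B. \<bar>of_bool (b = b0) :: real\<bar>) = (\<Sum>b\<in>B. if b = b0 then 1 else 0)"
      by (intro sum.cong) auto
    with b0 B(1) show ?thesis by simp
  qed
  then have "(\<lambda>b. of_bool (b = b0)) \<in> S" using b0 by (auto simp: S_def)
  then have ne: "S \<noteq> {}" by blast
  have "continuous_on S ?g"
    using continuous_on_sublinear_coordinates[OF sub B(1)] by (rule continuous_on_subset) simp
  from continuous_attains_inf[OF compact_l1_sphere[OF B(1), folded S_def] ne this]
  obtain u0 where u0: "u0 \<in> S" and min: "\<And>u. u \<in> S \<Longrightarrow> ?g u0 \<le> ?g u" by blast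
  have "?g u0 \<noteq> 0"
  proof
    assume "?g u0 = 0"
    then have "(\<Sum>b\<in>B. u0 b *\<^sub>R b) = 0" using \<gamma> by (simp add: is_gauge_def)
    then have "\<forall>b\<in>B. u0 b = 0" using independentD[OF B(2,1) subset_refl] by blast
    with u0 show False by (simp add: S_def)
  qed
  then have pos: "0 < ?g u0" using gauge_nonneg[OF \<gamma>] by (simp add: order_less_le)
  show ?thesis
  proof (rule that[OF pos])
    fix u :: "'a \<Rightarrow> real"
    define r where "r = (\<Sum>b\<in>B. \<bar>u b\<bar>)"
    show "?g u0 * (\<Sum>b\<in>B. \<bar>u b\<bar>) \<le> ?g u"
    proof (cases "r = 0")
      case True
      then show ?thesis using gauge_nonneg[OF \<gamma>] by (simp add: r_def)
    next
      case False
      moreover have "0 \<le> r" unfolding r_def by (intro sum_nonneg) auto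
      ultimately have r: "0 < r" by simp
      define w where "w b = (if b \<in> B then u b / r else 0)" for b
      have "(\<Sum>b\<in>B. \<bar>w b\<bar>) = (\<Sum>b\<in>B. \<bar>u b\<bar>) / r"
        using r by (simp add: w_def sum_divide_distrib)
      then have "w \<in> S" using r by (simp add: S_def w_def r_def)
      moreover have "(\<Sum>b\<in>B. w b *\<^sub>R b) = (1 / r) *\<^sub>R (\<Sum>b\<in>B. u b *\<^sub>R b)"
        by (simp add: w_def scaleR_sum_right)
      then have "?g w = ?g u / r" using sublinear_scaleR[OF sub, of "1 / r"] r by simp
      ultimately show ?thesis using min[of w] r by (simp add: field_simps r_def)
    qed
  qed
qed

lemma linear_le_gauge:
  fixes B :: "'a::real_vector set"
  assumes \<gamma>: "is_gauge \<gamma>" and B: "finite B" "independent B" "span B = UNIV" and \<phi>: "linear (\<phi> :: 'a \<Rightarrow> real)"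
  obtains c where "0 < c" "\<And>x. \<phi> x \<le> c * \<gamma> x"
proof -
  obtain m where m: "0 < m" "\<And>u. m * (\<Sum>b\<in>B. \<bar>u b\<bar>) \<le> \<gamma> (\<Sum>b\<in>B. u b *\<^sub>R b)"
    using gauge_ge_l1[OF \<gamma> B(1,2)] by blast
  define M where "M = 1 + (\<Sum>b\<in>B. \<bar>\<phi> b\<bar>)"
  have M: "0 < M" unfolding M_def by (intro add_pos_nonneg sum_nonneg) auto
  have "\<phi> x \<le> M / m * \<gamma> x" for x
  proof -
    have "x \<in> range (\<lambda>u. \<Sum>b\<in>B. u b *\<^sub>R b)"
      using span_finite[OF B(1)] unfolding B(3) by (rule subst) (rule UNIV_I)
    then obtain u where x: "x = (\<Sum>b\<in>B. u b *\<^sub>R b)" by (rule rangeE)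
    have "\<phi> x = (\<Sum>b\<in>B. u b * \<phi> b)"
      by (simp add: x linear_sum[OF \<phi>] linear_scale[OF \<phi>])
    also have "\<dots> \<le> (\<Sum>b\<in>B. \<bar>u b\<bar> * M)"
    proof (rule sum_mono)
      fix b assume "b \<in> B"
      then have "\<bar>\<phi> b\<bar> \<le> M"
        using member_le_sum[of b B "\<lambda>b. \<bar>\<phi> b\<bar>"] B(1) by (simp add: M_def)
      then have "\<bar>u b\<bar> * \<bar>\<phi> b\<bar> \<le> \<bar>u b\<bar> * M" by (simp add: mult_left_mono)
      then show "u b * \<phi> b \<le> \<bar>u b\<bar> * M" by (metis abs_ge_self abs_mult order_trans)
    qed
    also have "\<dots> = M / m * (m * (\<Sum>b\<in>B. \<bar>u b\<bar>))"
      using m(1) by (simp flip: sum_distrib_right)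
    also have "\<dots> \<le> M / m * \<gamma> x"
      using m M by (intro mult_left_mono) (auto simp: x)
    finally show ?thesis .
  qed
  with m M show ?thesis using that[of "M / m"] by simp
qed

text \<open>
  The inequality \<open>\<phi> x \<le> c * \<gamma> x\<close> passes to the infimum over \<open>c\<close>. The infimum ranges over a non-empty set by \<open>linear_le_gauge\<close>; without this, the
  bound on \<open>gauge_polar\<close> would say nothing about \<open>\<phi>\<close>.
\<close>

lemma gauge_polar_le_one_iff:
  fixes B :: "'a::real_vector set"
  assumes \<gamma>: "is_gauge \<gamma>" and B: "finite B" "independent B" "span B = UNIV" and \<phi>: "linear (\<phi> :: 'a \<Rightarrow> real)"
  shows "gauge_polar \<gamma> \<phi> \<le> 1 \<longleftrightarrow> (\<forall>x. \<phi> x \<le> \<gamma> x)"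
proof
  let ?C = "{c. 0 < c \<and> (\<forall>x. \<phi> x \<le> c * \<gamma> x)}"
  assume le: "gauge_polar \<gamma> \<phi> \<le> 1"
  obtain c where c: "0 < c" "\<And>x. \<phi> x \<le> c * \<gamma> x"
    using linear_le_gauge[OF \<gamma> B \<phi>] by blast
  then have ne: "?C \<noteq> {}" by blast
  show "\<forall>x. \<phi> x \<le> \<gamma> x"
  proof
    fix x
    show "\<phi> x \<le> \<gamma> x"
    proof (cases "\<gamma> x = 0")
      case True
      with c(2)[of x] show ?thesis by simp
    next
      case False
      then have pos: "0 < \<gamma> x" using gauge_nonneg[OF \<gamma>, of x] by simp
      then have "\<phi> x / \<gamma> x \<le> Inf ?C"
        using ne by (intro cInf_greatest) (auto simp: field_simps)
      also have "\<dots> \<le> 1" using le by (simp add: gauge_polar_def)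
      finally show ?thesis using pos by simp
    qed
  qed
next
  assume "\<forall>x. \<phi> x \<le> \<gamma> x"
  then show "gauge_polar \<gamma> \<phi> \<le> 1"
    unfolding gauge_polar_def by (intro cInf_lower bdd_belowI[where m = 0]) auto
qed

lemma gauge_dist_le:
  assumes "is_gauge \<gamma>" "y \<in> K"
  shows "gauge_dist \<gamma> x K \<le> \<gamma> (y - x)"
  unfolding gauge_dist_def
  using assms by (intro cINF_lower bdd_belowI2[where m = 0]) (auto simp: gauge_nonneg)

lemma gauge_dist_nonneg:
  assumes "is_gauge \<gamma>" "K \<noteq> {}"
  shows "0 \<le> gauge_dist \<gamma> x K"
  unfolding gauge_dist_def using assms by (intro cINF_greatest) (auto simp: gauge_nonneg)

lemma gauge_dist_mem:
  assumes "is_gauge \<gamma>" "y \<in> K"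
  shows "gauge_dist \<gamma> y K = 0"
proof (rule antisym)
  show "gauge_dist \<gamma> y K \<le> 0"
    using gauge_dist_le[OF assms, of y] sublinear_zero[OF gauge_sublinear[OF assms(1)]] by simp
  show "0 \<le> gauge_dist \<gamma> y K" using assms by (intro gauge_dist_nonneg) auto
qed

lemma gauge_dist_translate_le:
  assumes \<gamma>: "is_gauge \<gamma>" and "K \<noteq> {}"
  shows "gauge_dist \<gamma> (x - v) K \<le> gauge_dist \<gamma> x K + \<gamma> v"
proof -
  have "gauge_dist \<gamma> (x - v) K - \<gamma> v \<le> \<gamma> (y - x)" if "y \<in> K" for y
    using gauge_dist_le[OF \<gamma> that, of "x - v"] sublinear_add[OF gauge_sublinear[OF \<gamma>], of "y - x" v]
    by (simp add: algebra_simps)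
  then have "gauge_dist \<gamma> (x - v) K - \<gamma> v \<le> gauge_dist \<gamma> x K"
    unfolding gauge_dist_def[of \<gamma> x] using assms(2) by (intro cINF_greatest)
  then show ?thesis by simp
qed

lemma convex_on_gauge_dist:
  fixes K :: "'a::real_vector set"
  assumes \<gamma>: "is_gauge \<gamma>" and K: "K \<noteq> {}" "convex K"
  shows "convex_on UNIV (\<lambda>x. gauge_dist \<gamma> x K)"
proof
  fix t :: real and x y :: 'a assume t: "0 < t" "t < 1"
  note sub = gauge_sublinear[OF \<gamma>]
  let ?z = "(1 - t) *\<^sub>R x + t *\<^sub>R y"
  have "gauge_dist \<gamma> ?z K \<le> (1 - t) * \<gamma> (a - x) + t * \<gamma> (b - y)" if ab: "a \<in> K" "b \<in> K" for a b
  proof -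
    let ?c = "(1 - t) *\<^sub>R a + t *\<^sub>R b"
    have "?c \<in> K" using K(2) ab t by (simp add: convex_alt)
    then have "gauge_dist \<gamma> ?z K \<le> \<gamma> (?c - ?z)" by (rule gauge_dist_le[OF \<gamma>])
    also have "?c - ?z = (1 - t) *\<^sub>R (a - x) + t *\<^sub>R (b - y)" by (simp add: algebra_simps)
    also have "\<gamma> \<dots> \<le> (1 - t) * \<gamma> (a - x) + t * \<gamma> (b - y)"
      using sublinear_add[OF sub, of "(1 - t) *\<^sub>R (a - x)" "t *\<^sub>R (b - y)"] t
      by (simp add: sublinear_scaleR[OF sub])
    finally show ?thesis .
  qed
  with t K(1) show "gauge_dist \<gamma> ?z K \<le> (1 - t) * gauge_dist \<gamma> x K + t * gauge_dist \<gamma> y K"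
    unfolding gauge_dist_def[of \<gamma> x] gauge_dist_def[of \<gamma> y]
    by (intro weighted_cINF_greatest) auto
qed simp

text \<open>
  Being the greatest lower bound in the extended reals is a condition on real lower bounds alone
  when the index set is non-empty: \<open>- \<infinity>\<close> lies below \<open>d\<close>, and \<open>\<infinity>\<close> is not a lower bound.
\<close>

lemma ereal_eq_INF_iff:
  assumes "K \<noteq> {}"
  shows "ereal d = (INF y\<in>K. ereal (g y)) \<longleftrightarrow> (\<forall>y\<in>K. d \<le> g y) \<and> (\<forall>c. (\<forall>y\<in>K. c \<le> g y) \<longrightarrow> c \<le> d)"
proof
  assume eq: "ereal d = (INF y\<in>K. ereal (g y))"
  have "d \<le> g y" if "y \<in> K" for y
    using INF_lower[OF that, of "\<lambda>y. ereal (g y)"] unfolding eq[symmetric] by simp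
  moreover have "c \<le> d" if "\<forall>y\<in>K. c \<le> g y" for c
    using INF_greatest[of K "ereal c" "\<lambda>y. ereal (g y)"] that unfolding eq[symmetric] by simp
  ultimately show "(\<forall>y\<in>K. d \<le> g y) \<and> (\<forall>c. (\<forall>y\<in>K. c \<le> g y) \<longrightarrow> c \<le> d)" by blast
next
  assume d: "(\<forall>y\<in>K. d \<le> g y) \<and> (\<forall>c. (\<forall>y\<in>K. c \<le> g y) \<longrightarrow> c \<le> d)"
  let ?I = "INF y\<in>K. ereal (g y)"
  have le: "ereal d \<le> ?I" using d by (intro INF_greatest) simp
  obtain y0 where "y0 \<in> K" using assms by blast
  then have "?I \<le> ereal (g y0)" by (rule INF_lower)
  with le obtain c where c: "?I = ereal c" by (cases ?I) auto
  have "c \<le> g y" if "y \<in> K" for y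
    using INF_lower[OF that, of "\<lambda>y. ereal (g y)"] unfolding c by simp
  with d have "c \<le> d" by blast
  with le show "ereal d = ?I" unfolding c by simp
qed

text \<open>
  A subgradient satisfies \<open>- \<phi> \<le> \<gamma>\<close> because moving \<open>x\<close> by \<open>- v\<close> increases the distance by at most
  \<open>\<gamma> v\<close>, and \<open>dist x \<le> \<phi> (x - y)\<close> because the distance vanishes at \<open>y \<in> K\<close>. Conversely,
  \<open>- \<phi> \<le> \<gamma>\<close> makes \<open>inf\<^sub>y \<phi> (z - y)\<close> a lower bound for the distance at every \<open>z\<close>. As a function of
  \<open>z\<close> this bound is affine with slope \<open>\<phi>\<close>, so equality at \<open>x\<close> makes \<open>\<phi>\<close> a subgradient there.
\<close>

lemma subgradient_gauge_dist_iff: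
  assumes \<gamma>: "is_gauge \<gamma>" and K: "K \<noteq> {}" and \<phi>: "linear \<phi>"
  shows "subgradient (\<lambda>x. gauge_dist \<gamma> x K) x \<phi> \<longleftrightarrow>
    (\<forall>v. - \<phi> v \<le> \<gamma> v) \<and> ereal (gauge_dist \<gamma> x K) = (INF y\<in>K. ereal (\<phi> (x - y)))"
    (is "?sub \<longleftrightarrow> ?le \<and> ?eq")
proof -
  let ?d = "\<lambda>x. gauge_dist \<gamma> x K"
  have below: "c \<le> ?d z" if "?le" "\<forall>y\<in>K. c \<le> \<phi> (z - y)" for c z
    unfolding gauge_dist_def
  proof (rule cINF_greatest[OF K])
    fix y assume "y \<in> K"
    with that(2) have "c \<le> \<phi> (z - y)" by blast
    also have "\<dots> = - \<phi> (y - z)" by (simp add: linear_diff[OF \<phi>])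
    also have "\<dots> \<le> \<gamma> (y - z)" using that(1) by blast
    finally show "c \<le> \<gamma> (y - z)" .
  qed
  show ?thesis
  proof
    assume ?sub
    then have sub: "?d x + \<phi> (y - x) \<le> ?d y" for y by (simp add: subgradient_def)
    have ?le
    proof
      fix v
      show "- \<phi> v \<le> \<gamma> v"
        using sub[of "x - v"] gauge_dist_translate_le[OF \<gamma> K, of x v] by (simp add: linear_neg[OF \<phi>])
    qed
    moreover have "?d x \<le> \<phi> (x - y)" if "y \<in> K" for y
      using sub[of y] gauge_dist_mem[OF \<gamma> that] by (simp add: linear_diff[OF \<phi>])
    ultimately show "?le \<and> ?eq"
      using below[of _ x] unfolding ereal_eq_INF_iff[OF K] by blast
  next
    assume R: "?le \<and> ?eq"
    have "?d x + \<phi> (z - x) \<le> ?d z" for z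
    proof (rule below)
      show "\<forall>y\<in>K. ?d x + \<phi> (z - x) \<le> \<phi> (z - y)"
        using R unfolding ereal_eq_INF_iff[OF K] by (auto simp: linear_diff[OF \<phi>])
    qed (use R in blast)
    with \<phi> show ?sub by (simp add: subgradient_def)
  qed
qed

section \<open>The optimality condition\<close>

theorem theorem4p1:
  fixes B :: "'a::real_normed_vector set"
    and n :: nat
    and K :: "nat \<Rightarrow> 'a set"
    and \<gamma> :: "nat \<Rightarrow> 'a \<Rightarrow> real"
    and xbar :: 'a
  assumes "finite_dimensional_vector_space (scaleR :: real \<Rightarrow> 'a \<Rightarrow> 'a) B"
    and "\<And>i. i \<in> {1..n} \<Longrightarrow> K i \<noteq> {} \<and> closed (K i) \<and> convex (K i)"
    and "\<And>i. i \<in> {1..n} \<Longrightarrow> is_gauge (\<gamma> i)"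
  shows "is_arg_min (\<lambda>x. \<Sum>i=1..n. gauge_dist (\<gamma> i) x (K i)) (\<lambda>x. True) xbar \<longleftrightarrow>
    (\<exists>\<phi> :: nat \<Rightarrow> 'a \<Rightarrow> real.
       (\<forall>i\<in>{1..n}. linear (\<phi> i) \<and>
          gauge_polar (\<gamma> i) (\<lambda>x. - \<phi> i x) \<le> 1 \<and>
          ereal (gauge_dist (\<gamma> i) xbar (K i)) = (INF y\<in>K i. ereal (\<phi> i (xbar - y)))) \<and>
       (\<forall>x. (\<Sum>i=1..n. \<phi> i x) = 0))"
proof -
  have B: "finite B" "independent B" "span B = UNIV"
    using finite_dimensional_vector_space.finite_Basis[OF assms(1)]
      finite_dimensional_vector_space.independent_Basis[OF assms(1)]
      finite_dimensional_vector_space.span_Basis[OF assms(1)]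
    by (simp_all add: dependent_raw_def span_raw_def)
  let ?d = "\<lambda>i x. gauge_dist (\<gamma> i) x (K i)"
  let ?f = "\<lambda>x. \<Sum>i=1..n. ?d i x"
  have min_iff: "is_arg_min ?f (\<lambda>x. True) xbar \<longleftrightarrow> subgradient ?f xbar (\<lambda>_. 0)"
    by (simp add: is_arg_min_def subgradient_def not_less linear_zero)
  have split: "subgradient ?f xbar (\<lambda>_. 0) \<longleftrightarrow>
    (\<exists>\<phi>. (\<forall>i\<in>{1..n}. subgradient (?d i) xbar (\<phi> i)) \<and> (\<forall>x. (\<Sum>i=1..n. \<phi> i x) = 0))"
    (is "_ \<longleftrightarrow> ?S")
  proof
    assume sub: "subgradient ?f xbar (\<lambda>_. 0)"
    have "convex_on UNIV (?d i)" if "i \<in> {1..n}" for i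
      using assms(2,3)[OF that] by (intro convex_on_gauge_dist) auto
    then obtain \<psi> where "\<And>i. i \<in> {1..n} \<Longrightarrow> subgradient (?d i) xbar (\<psi> i)"
        "\<And>v. (\<Sum>i=1..n. \<psi> i v) = 0"
      using subgradient_sum_split[OF B(1,3) finite_atLeastAtMost _ sub] by blast
    then show ?S by blast
  next
    assume ?S
    then obtain \<phi> where \<phi>: "\<And>i. i \<in> {1..n} \<Longrightarrow> subgradient (?d i) xbar (\<phi> i)"
      and zero: "\<And>x. (\<Sum>i=1..n. \<phi> i x) = 0" by blast
    have "?f xbar \<le> ?f y" for y
    proof -
      have "(\<Sum>i=1..n. ?d i xbar + \<phi> i (y - xbar)) \<le> ?f y"
        using \<phi> by (intro sum_mono subgradientD(2))
      then show ?thesis unfolding sum.distrib zero by simp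
    qed
    then show "subgradient ?f xbar (\<lambda>_. 0)" by (simp add: subgradient_def linear_zero)
  qed
  have char: "subgradient (?d i) xbar \<phi> \<longleftrightarrow> linear \<phi> \<and> gauge_polar (\<gamma> i) (\<lambda>x. - \<phi> x) \<le> 1 \<and>
      ereal (?d i xbar) = (INF y\<in>K i. ereal (\<phi> (xbar - y)))" if i: "i \<in> {1..n}" for i \<phi>
  proof (cases "linear \<phi>")
    case True
    then show ?thesis
      using subgradient_gauge_dist_iff[OF assms(3)[OF i] _ True, of "K i" xbar] assms(2)[OF i]
        gauge_polar_le_one_iff[OF assms(3)[OF i] B linear_compose_neg[OF True]] by simp
  qed (simp add: subgradient_def)
  show ?thesis
    unfolding min_iff split by (simp only: char cong: ball_cong)
qed

end
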